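(* Let $P$ be a finite unicycle poset, that is, a finite poset whose cover graph is connected and contains exactly one cycle. Then the order dimension of $P$ is at most $3$.
   Context: The cover graph of a poset is the undirected graph underlying its Hasse diagram. The order dimension of a poset $P$ is the smallest number of linear extensions of $P$ whose intersection is $P$ (i.e. $u\le v$ in $P$ if and only if $u\le v$ in each of the chosen linear extensions); equivalently, the smallest $n$ such that $P$ is isomorphic to a subposet of $\mathbb{R}^n$ with the componentwise order. *)

theory Defs
  imports "HOL-Library.Extended_Nat" "Graph_Theory.Digraph_Component"
begin

text \<open>
  A poset is a carrier set \<open>A\<close> with a reflexive order relation \<open>r\<close> such that \<open>partial_order_on A r\<close>.
\<close>

definition hasse_diagram :: "'a set \<Rightarrow> 'a rel \<Rightarrow> 'a pair_pre_digraph" where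
  "hasse_diagram A r =
     \<lparr> pverts = A,
       parcs = {(x, y). (x, y) \<in> r \<and> x \<noteq> y \<and>
                        \<not> (\<exists>z. z \<noteq> x \<and> z \<noteq> y \<and> (x, z) \<in> r \<and> (z, y) \<in> r)} \<rparr>"

text \<open>Undirected graphs are represented, as usual in \<open>Graph_Theory\<close>, by symmetric digraphs.\<close>

definition cover_graph :: "'a set \<Rightarrow> 'a rel \<Rightarrow> 'a pair_pre_digraph" where
  "cover_graph A r = mk_symmetric (with_proj (hasse_diagram A r))"

text \<open>
  The edge sets of the cycles of an undirected graph, given as a symmetric digraph without loops.
  The closed arc walks accepted by \<^const>\<open>pre_digraph.cycle\<close> include \<open>u, v, u\<close>, which traverses a
  single undirected edge back and forth; the bound on the length excludes it.  Two closed walks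
  which differ only in starting point or direction describe the same cycle, so a cycle is
  identified with its set of undirected edges.
\<close>

definition undirected_cycles :: "'a pair_pre_digraph \<Rightarrow> 'a set set set" where
  "undirected_cycles G =
     {(\<lambda>(u, v). {u, v}) ` set p | p. pre_digraph.cycle (with_proj G) p \<and> 3 \<le> length p}"

definition unicycle_poset :: "'a set \<Rightarrow> 'a rel \<Rightarrow> bool" where
  "unicycle_poset A r \<longleftrightarrow>
     partial_order_on A r \<and>
     Digraph_Component.connected (with_proj (cover_graph A r)) \<and>
     (\<exists>!C. C \<in> undirected_cycles (cover_graph A r))"

definition linear_extension :: "'a set \<Rightarrow> 'a rel \<Rightarrow> 'a rel \<Rightarrow> bool" where
  "linear_extension A r l \<longleftrightarrow> linear_order_on A l \<and> r \<subseteq> l"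

text \<open>
  The intersection is taken inside \<open>A \<times> A\<close>, so that the empty family realizes exactly the
  posets with at most one element.
\<close>

definition realizer :: "'a set \<Rightarrow> 'a rel \<Rightarrow> 'a rel set \<Rightarrow> bool" where
  "realizer A r L \<longleftrightarrow>
     (\<forall>l\<in>L. linear_extension A r l) \<and>
     (\<forall>u\<in>A. \<forall>v\<in>A. (u, v) \<in> r \<longleftrightarrow> (\<forall>l\<in>L. (u, v) \<in> l))"

text \<open>The value is \<open>\<infinity>\<close> if there is no finite realizer.\<close>

definition order_dimension :: "'a set \<Rightarrow> 'a rel \<Rightarrow> enat" where
  "order_dimension A r = (INF L \<in> {L. finite L \<and> realizer A r L}. enat (card L))"

lemma order_dimension_le_iff:
  "order_dimension A r \<le> enat n \<longleftrightarrow> (\<exists>L. finite L \<and> card L \<le> n \<and> realizer A r L)"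
proof
  assume "order_dimension A r \<le> enat n"
  then have "order_dimension A r < enat (Suc n)"
    by (metis enat_ord_simps(2) lessI order_le_less_trans)
  then show "\<exists>L. finite L \<and> card L \<le> n \<and> realizer A r L"
    by (auto simp: order_dimension_def INF_less_iff less_Suc_eq_le)
next
  assume "\<exists>L. finite L \<and> card L \<le> n \<and> realizer A r L"
  then show "order_dimension A r \<le> enat n"
    unfolding order_dimension_def by (auto intro: INF_lower2)
qed

end

theory Submission
  imports Defs
begin
text \<open>
  A finite poset is the reachability order of its covering arcs, so the task is to arrange the
  vertices in three lists such that \<open>x\<close> reaches \<open>y\<close> exactly if \<open>x\<close> precedes \<open>y\<close> in all of them.

  Choose \<open>m\<close> maximal among the upper ends of arcs on the cycle.  Both cycle arcs at \<open>m\<close> then enter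
  it, say from \<open>x\<close> and from \<open>z\<close>.  Deleting these two arcs leaves two trees: \<open>D\<close> containing \<open>m\<close>, and
  \<open>S\<close> containing \<open>x\<close> and \<open>z\<close>, which the remainder of the cycle connects.  An element \<open>s\<close> of \<open>S\<close> lies
  below an element \<open>d\<close> of \<open>D\<close> iff \<open>s\<close> is in the down-set of \<open>{x, z}\<close> and \<open>d\<close> in the up-set of \<open>m\<close>.
  Hence realizers of \<open>S\<close> and \<open>D\<close> combine as soon as one list for \<open>S\<close> starts with the down-set of
  \<open>{x, z}\<close> and one list for \<open>D\<close> ends with the up-set of \<open>m\<close>: the first of these lists has all of \<open>D\<close>
  inserted after its initial segment, the second has all of \<open>S\<close> inserted before its final segment,
  and the third list puts all of \<open>S\<close> before \<open>D\<close> (\<open>birooted_rooted_top\<close>).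

  Lists suitable for \<open>D\<close> are built by gluing subtrees along the arcs at the root (\<open>rooted\<close>,
  \<open>rooted_join\<close>).  For \<open>S\<close> the path between \<open>x\<close> and \<open>z\<close> is followed from \<open>z\<close> to \<open>x\<close>, and at each step
  the next vertex on the path is attached together with the subtree that hangs off it; the predicate
  \<open>birooted\<close> is the invariant that survives both upward and downward steps
  (\<open>birooted_join_above\<close>, \<open>birooted_join_below\<close>).

  On the graph side, trees are handled through the property that no arc joins two vertices that
  stay linked without it.  An arc without this property lies on a cycle, and if two such arcs could
  be chosen one after the other, the second in the graph without the first, there would be two
  different cycles (\<open>non_bridge_on_cycle\<close>).
\<close>

section \<open>Orders realized by three lists\<close>

fun precedes :: "'a list \<Rightarrow> 'a \<Rightarrow> 'a \<Rightarrow> bool" where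
  "precedes [] x y \<longleftrightarrow> False"
| "precedes (z # l) x y \<longleftrightarrow> x = z \<and> y \<in> set (z # l) \<or> precedes l x y"

lemma precedes_in: "precedes l x y \<Longrightarrow> x \<in> set l \<and> y \<in> set l"
  by (induction l) auto

lemma precedes_append:
  "precedes (l @ m) x y \<longleftrightarrow> precedes l x y \<or> precedes m x y \<or> x \<in> set l \<and> y \<in> set m"
  by (induction l) auto

lemma precedes_refl: "x \<in> set l \<Longrightarrow> precedes l x x"
  by (induction l) auto

lemma precedes_total: "x \<in> set l \<Longrightarrow> y \<in> set l \<Longrightarrow> precedes l x y \<or> precedes l y x"
  by (induction l) auto

lemma precedes_antisym: "distinct l \<Longrightarrow> precedes l x y \<Longrightarrow> precedes l y x \<Longrightarrow> x = y"
  by (induction l) (auto dest: precedes_in)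

lemma precedes_trans: "distinct l \<Longrightarrow> precedes l x y \<Longrightarrow> precedes l y z \<Longrightarrow> precedes l x z"
  by (induction l) (auto dest: precedes_in)

lemma precedes_notin: "x \<notin> set l \<Longrightarrow> \<not> precedes l x y" "y \<notin> set l \<Longrightarrow> \<not> precedes l x y"
  by (auto dest: precedes_in)

definition realized_by :: "'a set \<Rightarrow> 'a rel \<Rightarrow> 'a list \<Rightarrow> 'a list \<Rightarrow> 'a list \<Rightarrow> bool" where
  "realized_by V R l1 l2 l3 \<longleftrightarrow>
     (\<forall>l\<in>{l1, l2, l3}. distinct l \<and> set l = V) \<and> R \<subseteq> V \<times> V \<and>
     (\<forall>x\<in>V. \<forall>y\<in>V. (x, y) \<in> R \<longleftrightarrow> precedes l1 x y \<and> precedes l2 x y \<and> precedes l3 x y)"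

text \<open>
  The strengthened statement for trees: besides realizing the order, the second list ends with the
  up-set of the root \<open>p\<close> and the third starts with its down-set.  These are the places at which
  another tree can be cut in along an arc at \<open>p\<close>.
\<close>

definition rooted :: "'a set \<Rightarrow> 'a rel \<Rightarrow> 'a \<Rightarrow> bool" where
  "rooted V R p \<longleftrightarrow> p \<in> V \<and>
     (\<exists>l h u d k. realized_by V R l (h @ u) (d @ k) \<and> set u = R `` {p} \<and> set d = R\<inverse> `` {p})"

text \<open>
  The order obtained from disjoint orders \<open>R\<close> and \<open>S\<close> by adding an arc from \<open>a\<close> in \<open>R\<close> to \<open>b\<close> in \<open>S\<close>.
\<close>

definition join :: "'a rel \<Rightarrow> 'a \<Rightarrow> 'a \<Rightarrow> 'a rel \<Rightarrow> 'a rel" where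
  "join R a b S = R \<union> S \<union> R\<inverse> `` {a} \<times> S `` {b}"

lemma realized_by_refl: "realized_by V R l1 l2 l3 \<Longrightarrow> x \<in> V \<Longrightarrow> (x, x) \<in> R"
  by (auto simp: realized_by_def precedes_refl)

lemma realized_by_trans:
  assumes "realized_by V R l1 l2 l3" "(x, y) \<in> R" "(y, z) \<in> R" shows "(x, z) \<in> R"
proof -
  have "x \<in> V" "y \<in> V" "z \<in> V" using assms by (auto simp: realized_by_def)
  with assms show ?thesis unfolding realized_by_def by (meson insertCI precedes_trans)
qed

lemma rootedI:
  "realized_by V R l (h @ u) (d @ k) \<Longrightarrow> set u = R `` {p} \<Longrightarrow> set d = R\<inverse> `` {p} \<Longrightarrow> p \<in> V
    \<Longrightarrow> rooted V R p"
  unfolding rooted_def by blast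

lemma rooted_singleton: "rooted {p} {(p, p)} p"
  by (rule rootedI[of _ _ "[p]" "[]" "[p]" "[p]" "[]"]) (auto simp: realized_by_def)

text \<open>
  Interleaving two realizers leaves the comparisons inside either part untouched, so only the pairs
  with one element in each part have to be examined.
\<close>

lemma realized_by_joinI:
  assumes R: "realized_by V R l1 l2 l3" and S: "realized_by W S m1 m2 m3"
    and VW: "V \<inter> W = {}"
    and n: "\<forall>n\<in>{n1, n2, n3}. distinct n \<and> set n = V \<union> W"
    and nV: "\<forall>x\<in>V. \<forall>y\<in>V. precedes n1 x y = precedes l1 x y \<and>
      precedes n2 x y = precedes l2 x y \<and> precedes n3 x y = precedes l3 x y"
    and nW: "\<forall>x\<in>W. \<forall>y\<in>W. precedes n1 x y = precedes m1 x y \<and>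
      precedes n2 x y = precedes m2 x y \<and> precedes n3 x y = precedes m3 x y"
    and C: "C \<subseteq> V \<times> W"
    and up: "\<And>x y. x \<in> V \<Longrightarrow> y \<in> W \<Longrightarrow>
      (x, y) \<in> C \<longleftrightarrow> precedes n1 x y \<and> precedes n2 x y \<and> precedes n3 x y"
    and down: "\<And>x y. x \<in> V \<Longrightarrow> y \<in> W \<Longrightarrow>
      \<not> (precedes n1 y x \<and> precedes n2 y x \<and> precedes n3 y x)"
  shows "realized_by (V \<union> W) (R \<union> S \<union> C) n1 n2 n3"
proof -
  have RS: "R \<subseteq> V \<times> V" "S \<subseteq> W \<times> W" using R S by (auto simp: realized_by_def)
  have "(x, y) \<in> R \<union> S \<union> C \<longleftrightarrow> precedes n1 x y \<and> precedes n2 x y \<and> precedes n3 x y"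
    if "x \<in> V \<union> W" "y \<in> V \<union> W" for x y
  proof -
    consider "x \<in> V" "y \<in> V" | "x \<in> W" "y \<in> W" | "x \<in> V" "y \<in> W" | "x \<in> W" "y \<in> V"
      using \<open>x \<in> _\<close> \<open>y \<in> _\<close> by blast
    then show ?thesis
    proof cases
      case 1
      then have "(x, y) \<notin> S \<union> C" using RS C VW by blast
      then show ?thesis using 1 R nV by (simp add: realized_by_def)
    next
      case 2
      then have "(x, y) \<notin> R \<union> C" using RS C VW by blast
      then show ?thesis using 2 S nW by (simp add: realized_by_def)
    next
      case 3
      then have "(x, y) \<notin> R \<union> S" using RS VW by blast
      then show ?thesis using up 3 by simp
    next
      case 4
      then have "(x, y) \<notin> R \<union> S \<union> C" using RS C VW by blast
      then show ?thesis using down 4 by blast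
    qed
  qed
  then show ?thesis using n RS C unfolding realized_by_def by blast
qed

section \<open>Gluing rooted trees along an arc\<close>

text \<open>
  In the second list everything of \<open>V\<close> goes just before the up-set of \<open>b\<close>, and in the third
  everything of \<open>W\<close> just after the down-set of \<open>a\<close>, so these two lists together admit exactly the
  pairs \<open>x \<le> a\<close>, \<open>b \<le> y\<close>; the first list excludes all pairs in the wrong direction.  The result
  is still arranged around \<open>a\<close> as well as around \<open>b\<close>.
\<close>

lemma rooted_join:
  assumes "rooted V R a" "rooted W S b" "V \<inter> W = {}"
  shows "rooted (V \<union> W) (join R a b S) a" "rooted (V \<union> W) (join R a b S) b"
proof -
  obtain l h u d k where R: "realized_by V R l (h @ u) (d @ k)"
      "set u = R `` {a}" "set d = R\<inverse> `` {a}" "a \<in> V"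
    using assms(1) unfolding rooted_def by blast
  obtain l' h' u' d' k' where S: "realized_by W S l' (h' @ u') (d' @ k')"
      "set u' = S `` {b}" "set d' = S\<inverse> `` {b}" "b \<in> W"
    using assms(2) unfolding rooted_def by blast
  have aa: "(a,a) \<in> R" "(b,b) \<in> S" using R S by (auto intro: realized_by_refl)
  have RV: "R \<subseteq> V \<times> V" "S \<subseteq> W \<times> W" using R S by (auto simp: realized_by_def)
  have dist: "distinct l" "distinct (h @ u)" "distinct (d @ k)"
    "distinct l'" "distinct (h' @ u')" "distinct (d' @ k')"
    using R(1) S(1) by (auto simp: realized_by_def)
  have sets: "set l = V" "set h \<union> set u = V" "set d \<union> set k = V"
     "set l' = W" "set h' \<union> set u' = W" "set d' \<union> set k' = W"
    using R(1) S(1) by (auto simp: realized_by_def)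
  have notin: "y \<notin> set l" "y \<notin> set h" "y \<notin> set u" "y \<notin> set d" "y \<notin> set k" if "y \<in> W" for y
    using sets that assms(3) by blast+
  have notin': "y \<notin> set l'" "y \<notin> set h'" "y \<notin> set u'" "y \<notin> set d'" "y \<notin> set k'" if "y \<in> V" for y
    using sets that assms(3) by blast+
  have real: "realized_by (V \<union> W) (join R a b S) (l @ l') (h' @ h @ u @ u') (d @ d' @ k' @ k)"
    unfolding join_def
    apply (rule realized_by_joinI[OF R(1) S(1) assms(3)])
    subgoal using dist sets assms(3) by auto
    subgoal by (simp add: precedes_append precedes_notin notin notin')
    subgoal by (simp add: precedes_append precedes_notin notin notin')
    subgoal using RV by auto
    subgoal for x y
    proof -
      assume xy: "x \<in> V" "y \<in> W"
      then have "precedes (l @ l') x y" "precedes (h' @ h @ u @ u') x y \<longleftrightarrow> y \<in> set u'"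
        "precedes (d @ d' @ k' @ k) x y \<longleftrightarrow> x \<in> set d"
        using sets by (auto simp: precedes_append precedes_notin notin notin')
      then show ?thesis using R(3) S(2) by auto
    qed
    subgoal for x y
    proof -
      assume "x \<in> V" "y \<in> W"
      then have "\<not> precedes (l @ l') y x" by (simp add: precedes_append precedes_notin notin notin')
      then show ?thesis by blast
    qed
    done
  have "realized_by (V \<union> W) (join R a b S) (l @ l') ((h' @ h) @ u @ u') (d @ d' @ k' @ k)"
    "realized_by (V \<union> W) (join R a b S) (l @ l') ((h' @ h @ u) @ u') ((d @ d') @ k' @ k)"
    using real by simp_all
  note real2 = this
  show "rooted (V \<union> W) (join R a b S) a"
    by (rule rootedI[OF real2(1)]) (use R(2-) S(2-) aa RV assms(3) in \<open>auto simp: join_def\<close>)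
  show "rooted (V \<union> W) (join R a b S) b"
    by (rule rootedI[OF real2(2)]) (use R(2-) S(2-) aa RV assms(3) in \<open>auto simp: join_def\<close>)
qed

section \<open>Trees grown along a path\<close>

lemma realized_by_swap: "realized_by V R l1 l2 l3 \<Longrightarrow> realized_by V R l2 l1 l3"
  unfolding realized_by_def by blast

text \<open>
  The invariant for a tree grown along a path from \<open>v\<close> to its present end \<open>b\<close>.  The conjunct of
  interest is that \<open>k1 @ k2\<close>, an initial segment of the third list, is the down-set of \<open>{b, v}\<close>.
  The others keep this attainable for the next vertex of the path:

  \<^item> The initial segments \<open>n @ f\<close> of the first and \<open>k1 @ k2\<close> of the third list have exactly the
    down-set of \<open>b\<close> in common.  These are the cut points for a tree attached above \<open>b\<close>.

  \<^item> The final segment \<open>h\<close> of the second list exceeds the up-set of \<open>b\<close> by \<open>n\<close> only, with which the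
    first list begins.  So a tree cut in after \<open>n\<close> and before \<open>h\<close> has precisely the up-set of \<open>b\<close>
    after it in both lists.  These are the cut points for a tree attached below \<open>b\<close>.

  \<^item> The down-set of \<open>v\<close> occupies an initial segment \<open>k1\<close> of its own, because elements that are new
    below \<open>b\<close> may have to be placed directly after it.
\<close>

definition birooted :: "'a set \<Rightarrow> 'a rel \<Rightarrow> 'a \<Rightarrow> 'a \<Rightarrow> bool" where
  "birooted V R b v \<longleftrightarrow> b \<in> V \<and> v \<in> V \<and>
     (\<exists>n f g h' h k1 k2 k3. realized_by V R (n @ f @ g) (h' @ h) (k1 @ k2 @ k3) \<and>
       set h = set n \<union> R `` {b} \<and> set n \<inter> R `` {b} = {} \<and> set n \<inter> R\<inverse> `` {v} = {} \<and>
       R\<inverse> `` {b} \<subseteq> set n \<union> set f \<and> set f \<inter> R\<inverse> `` {v} \<subseteq> R\<inverse> `` {b} \<and>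
       set k1 = R\<inverse> `` {v} \<and> set k1 \<union> set k2 = R\<inverse> `` {v} \<union> R\<inverse> `` {b})"

lemma birootedI:
  assumes "realized_by V R (n @ f @ g) (h' @ h) (k1 @ k2 @ k3)" "b \<in> V" "v \<in> V"
    "set h = set n \<union> R `` {b}" "set n \<inter> R `` {b} = {}" "set n \<inter> R\<inverse> `` {v} = {}"
    "R\<inverse> `` {b} \<subseteq> set n \<union> set f" "set f \<inter> R\<inverse> `` {v} \<subseteq> R\<inverse> `` {b}"
    "set k1 = R\<inverse> `` {v}" "set k1 \<union> set k2 = R\<inverse> `` {v} \<union> R\<inverse> `` {b}"
  shows "birooted V R b v"
  unfolding birooted_def using assms by blast

lemma birooted_refl:
  assumes "rooted V R v" shows "birooted V R v v"
proof -
  obtain l h u d k where R: "realized_by V R l (h @ u) (d @ k)"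
      "set u = R `` {v}" "set d = R\<inverse> `` {v}" "v \<in> V"
    using assms(1) unfolding rooted_def by blast
  then have "R \<subseteq> V \<times> V" "set l = V" by (auto simp: realized_by_def)
  with R show ?thesis
    by (intro birootedI[of V R "[]" l "[]" h u d "[]" k]) auto
qed

text \<open>
  The new tree enters the first list in two pieces: the elements not above \<open>a\<close> come first of all, and
  play the part of \<open>n\<close> from now on; those above \<open>a\<close> come after \<open>n @ f\<close>.  In the third list it
  follows \<open>k1 @ k2\<close>.  An old \<open>x\<close> thus precedes a new \<open>y\<close> everywhere iff \<open>a \<le> y\<close> and \<open>x\<close> lies in both
  \<open>n @ f\<close> and \<open>k1 @ k2\<close>, that is \<open>x \<le> b\<close>.
\<close>

lemma birooted_join_above:
  assumes "birooted V R b v" "rooted W S a" "V \<inter> W = {}"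
  shows "birooted (V \<union> W) (join R b a S) a v"
proof -
  obtain n f g h' h k1 k2 k3 where R: "realized_by V R (n @ f @ g) (h' @ h) (k1 @ k2 @ k3)"
    and bv: "b \<in> V" "v \<in> V"
    and inv: "set h = set n \<union> R `` {b}" "set n \<inter> R `` {b} = {}" "set n \<inter> R\<inverse> `` {v} = {}"
    "R\<inverse> `` {b} \<subseteq> set n \<union> set f" "set f \<inter> R\<inverse> `` {v} \<subseteq> R\<inverse> `` {b}"
    "set k1 = R\<inverse> `` {v}" "set k1 \<union> set k2 = R\<inverse> `` {v} \<union> R\<inverse> `` {b}"
    using assms(1) unfolding birooted_def by blast
  obtain l z u d w where S: "realized_by W S l (z @ u) (d @ w)"
    and ud: "set u = S `` {a}" "set d = S\<inverse> `` {a}"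
    and a: "a \<in> W"
    using assms(2) unfolding rooted_def by blast
  have aa: "(a, a) \<in> S" "(b, b) \<in> R" using R S a bv by (auto intro: realized_by_refl)
  have RV: "R \<subseteq> V \<times> V" "S \<subseteq> W \<times> W" using R S by (auto simp: realized_by_def)
  have dist: "distinct (n @ f @ g)" "distinct (h' @ h)" "distinct (k1 @ k2 @ k3)"
      "distinct l" "distinct (z @ u)" "distinct (d @ w)"
    using R S by (auto simp: realized_by_def)
  have sets: "set n \<union> set f \<union> set g = V" "set h' \<union> set h = V" "set k1 \<union> set k2 \<union> set k3 = V"
     "set l = W" "set z \<union> set u = W" "set d \<union> set w = W"
    using R S by (auto simp: realized_by_def)
  have notin: "y \<notin> set n" "y \<notin> set f" "y \<notin> set g" "y \<notin> set h'" "y \<notin> set h"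
    "y \<notin> set k1" "y \<notin> set k2" "y \<notin> set k3" if "y \<in> W" for y
    using sets that assms(3) by blast+
  have notin': "y \<notin> set l" "y \<notin> set z" "y \<notin> set u" "y \<notin> set d" "y \<notin> set w" if "y \<in> V" for y
    using sets that assms(3) by blast+
  have "realized_by (V \<union> W) (join R b a S) (z @ n @ f @ u @ g) (h' @ h @ l) (k1 @ k2 @ d @ w @ k3)"
    unfolding join_def
    apply (rule realized_by_joinI[OF R realized_by_swap[OF S] assms(3)])
    subgoal using dist sets assms(3) by auto
    subgoal by (simp add: precedes_append precedes_notin notin notin')
    subgoal by (simp add: precedes_append precedes_notin notin notin')
    subgoal using RV by auto
    subgoal for x y
    proof -
      assume xy: "x \<in> V" "y \<in> W"
      then have "precedes (h' @ h @ l) x y"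
        "precedes (z @ n @ f @ u @ g) x y \<longleftrightarrow> (x \<in> set n \<union> set f) \<and> y \<in> set u"
        "precedes (k1 @ k2 @ d @ w @ k3) x y \<longleftrightarrow> x \<in> set k1 \<union> set k2"
        using sets by (auto simp: precedes_append precedes_notin notin notin')
      moreover have "x \<in> R\<inverse> `` {b} \<longleftrightarrow> x \<in> set n \<union> set f \<and> x \<in> set k1 \<union> set k2"
        unfolding inv(7) using inv(3-5) by blast
      ultimately show ?thesis using ud(1) by blast
    qed
    subgoal for x y
    proof -
      assume xy: "x \<in> V" "y \<in> W"
      then have "\<not> precedes (h' @ h @ l) y x"
        by (simp add: precedes_append precedes_notin notin notin')
      then show ?thesis by blast
    qed
    done
  then have real: "realized_by (V \<union> W) (join R b a S)
      (z @ (n @ f @ u) @ g) ((h' @ h) @ l) (k1 @ (k2 @ d) @ (w @ k3))"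
    by simp
  have up: "join R b a S `` {a} = S `` {a}" and dn: "(join R b a S)\<inverse> `` {a} = S\<inverse> `` {a} \<union> R\<inverse> `` {b}"
    and dv: "(join R b a S)\<inverse> `` {v} = R\<inverse> `` {v}"
    using RV assms(3) a aa bv unfolding join_def by blast+
  show ?thesis
    apply (rule birootedI[OF real])
    using bv a apply blast
    using bv a apply blast
    unfolding up dn dv
    subgoal using sets ud by auto
    subgoal using dist ud by auto
    subgoal using sets RV assms(3) by blast
    subgoal using sets ud inv RV by auto
    subgoal using inv ud RV assms(3) by auto
    subgoal using inv by auto
    subgoal using inv ud by auto
    done
qed

text \<open>
  The first two lists let a new element precede exactly the up-set of \<open>b\<close>, so it remains for the third
  to single out the down-set of \<open>a\<close>.  All other new elements go to its end.  The down-set of \<open>a\<close> goes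
  to its front if \<open>b \<le> v\<close>, since it then belongs to the down-set of \<open>v\<close>.  Otherwise no element above
  \<open>b\<close> is below \<open>v\<close>, and it can go after \<open>k1\<close>.
\<close>

lemma birooted_join_below:
  assumes "birooted V R b v" "rooted W S a" "V \<inter> W = {}"
  shows "birooted (W \<union> V) (join S a b R) a v"
proof -
  obtain n f g h' h k1 k2 k3 where R: "realized_by V R (n @ f @ g) (h' @ h) (k1 @ k2 @ k3)"
    and bv: "b \<in> V" "v \<in> V"
    and inv: "set h = set n \<union> R `` {b}" "set n \<inter> R `` {b} = {}" "set n \<inter> R\<inverse> `` {v} = {}"
    "R\<inverse> `` {b} \<subseteq> set n \<union> set f" "set f \<inter> R\<inverse> `` {v} \<subseteq> R\<inverse> `` {b}"
    "set k1 = R\<inverse> `` {v}" "set k1 \<union> set k2 = R\<inverse> `` {v} \<union> R\<inverse> `` {b}"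
    using assms(1) unfolding birooted_def by blast
  obtain l z u d w where S: "realized_by W S l (z @ u) (d @ w)"
    and ud: "set u = S `` {a}" "set d = S\<inverse> `` {a}"
    and a: "a \<in> W"
    using assms(2) unfolding rooted_def by blast
  have aa: "(a, a) \<in> S" "(b, b) \<in> R" using R S a bv by (auto intro: realized_by_refl)
  have RV: "R \<subseteq> V \<times> V" "S \<subseteq> W \<times> W" using R S by (auto simp: realized_by_def)
  have dist: "distinct (n @ f @ g)" "distinct (h' @ h)" "distinct (k1 @ k2 @ k3)"
      "distinct l" "distinct (z @ u)" "distinct (d @ w)"
    using R S by (auto simp: realized_by_def)
  have sets: "set n \<union> set f \<union> set g = V" "set h' \<union> set h = V" "set k1 \<union> set k2 \<union> set k3 = V"
     "set l = W" "set z \<union> set u = W" "set d \<union> set w = W"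
    using R S by (auto simp: realized_by_def)
  \<comment> \<open>The front of the third list and the gap behind \<open>k1\<close>; exactly one of them receives the down-set
    of \<open>a\<close>.\<close>
  define c1 where "c1 = (if (b, v) \<in> R then d else [])"
  define c2 where "c2 = (if (b, v) \<in> R then [] else d)"
  have c: "(b, v) \<in> R \<and> c1 = d \<and> c2 = [] \<or> (b, v) \<notin> R \<and> c1 = [] \<and> c2 = d"
    by (auto simp: c1_def c2_def)
  have notin: "y \<notin> set n" "y \<notin> set f" "y \<notin> set g" "y \<notin> set h'" "y \<notin> set h"
    "y \<notin> set k1" "y \<notin> set k2" "y \<notin> set k3" if "y \<in> W" for y
    using sets that assms(3) by blast+
  have notin': "y \<notin> set l" "y \<notin> set z" "y \<notin> set u" "y \<notin> set d" "y \<notin> set w"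
    "y \<notin> set c1" "y \<notin> set c2" if "y \<in> V" for y
    using sets that assms(3) c by auto
  have "realized_by (W \<union> V) (join S a b R) (n @ l @ f @ g) (h' @ z @ u @ h) (c1 @ k1 @ c2 @ k2 @ k3 @ w)"
    unfolding join_def
    apply (rule realized_by_joinI[OF S R])
    subgoal using assms(3) by blast
    subgoal using dist sets assms(3) c by auto
    subgoal using c by (auto simp: precedes_append precedes_notin notin notin')
    subgoal by (simp add: precedes_append precedes_notin notin notin')
    subgoal using RV by auto
    subgoal for x y
    proof -
      assume xy: "x \<in> W" "y \<in> V"
      have fg: "y \<in> set f \<union> set g \<longleftrightarrow> y \<notin> set n"
        using sets(1) dist(1) xy(2) by auto
      have "x \<in> set l" using xy sets(4) by simp
      then have "precedes (n @ l @ f @ g) x y \<longleftrightarrow> y \<notin> set n"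
        unfolding fg[symmetric] using xy by (simp add: precedes_append precedes_notin notin notin')
      moreover have "precedes (h' @ z @ u @ h) x y \<longleftrightarrow> y \<in> set h"
        using xy sets(5) by (auto simp: precedes_append precedes_notin notin notin')
      moreover have "precedes (c1 @ k1 @ c2 @ k2 @ k3 @ w) x y \<longleftrightarrow> x \<in> set d" if "y \<in> R `` {b}"
      proof (cases "(b, v) \<in> R")
        case True
        then show ?thesis using c xy sets(3) by (auto simp: precedes_append precedes_notin notin notin')
      next
        case False
        then have "y \<notin> set k1" using inv(6) that realized_by_trans[OF R] by blast
        then have "y \<in> set k2 \<union> set k3" using sets(3) xy by blast
        then show ?thesis using c xy False by (auto simp: precedes_append precedes_notin notin notin')
      qed
      ultimately show ?thesis using ud(2) inv(1,2) by blast
    qed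
    subgoal for x y
    proof -
      assume xy: "x \<in> W" "y \<in> V"
      have "precedes (n @ l @ f @ g) y x \<Longrightarrow> y \<in> set n" "precedes (h' @ z @ u @ h) y x \<Longrightarrow> y \<in> set h'"
        using xy by (auto simp: precedes_append precedes_notin notin notin')
      then show ?thesis using inv(1) dist(2) by auto
    qed
    done
  then have real: "realized_by (W \<union> V) (join S a b R)
      (n @ l @ (f @ g)) ((h' @ z) @ (u @ h)) ((c1 @ k1) @ c2 @ (k2 @ k3 @ w))"
    by simp
  have up: "join S a b R `` {a} = S `` {a} \<union> R `` {b}" and dn: "(join S a b R)\<inverse> `` {a} = S\<inverse> `` {a}"
    and dv: "(join S a b R)\<inverse> `` {v} = R\<inverse> `` {v} \<union> (if (b, v) \<in> R then S\<inverse> `` {a} else {})"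
    using RV assms(3) a aa bv unfolding join_def by auto
  show ?thesis
    apply (rule birootedI[OF real])
    using bv a apply blast
    using bv a apply blast
    unfolding up dn dv
    subgoal using ud inv by auto
    subgoal using sets inv RV assms(3) by blast
    subgoal using sets inv RV assms(3) by auto
    subgoal using sets RV by auto
    subgoal using sets RV assms(3) by auto
    subgoal using inv ud c by auto
    subgoal using inv ud c by auto
    done
qed

text \<open>
  The two arcs from \<open>x\<close> and \<open>z\<close> to \<open>m\<close> act like a single arc from the down-set of \<open>{x, z}\<close>, which
  is an initial segment of the third list for \<open>V\<close>.
\<close>

lemma birooted_rooted_top:
  assumes "birooted V R x z" "rooted W S m" "V \<inter> W = {}"
  shows "\<exists>l1 l2 l3. realized_by (V \<union> W) (R \<union> S \<union> R\<inverse> `` {x, z} \<times> S `` {m}) l1 l2 l3"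
proof -
  obtain s t k1 k2 k3 where R: "realized_by V R s t (k1 @ k2 @ k3)"
    and inv: "set k1 \<union> set k2 = R\<inverse> `` {z} \<union> R\<inverse> `` {x}"
    using assms(1) unfolding birooted_def by blast
  obtain l h u d where S: "realized_by W S l (h @ u) d" and u: "set u = S `` {m}"
    using assms(2) unfolding rooted_def by blast
  have RV: "R \<subseteq> V \<times> V" "S \<subseteq> W \<times> W" using R S by (auto simp: realized_by_def)
  have dist: "distinct s" "distinct t" "distinct (k1 @ k2 @ k3)"
      "distinct l" "distinct (h @ u)" "distinct d"
    using R S by (auto simp: realized_by_def)
  have sets: "set s = V" "set t = V" "set k1 \<union> set k2 \<union> set k3 = V"
     "set l = W" "set h \<union> set u = W" "set d = W"
    using R S by (auto simp: realized_by_def)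
  have notin: "y \<notin> set s" "y \<notin> set t" "y \<notin> set k1" "y \<notin> set k2" "y \<notin> set k3" if "y \<in> W" for y
    using sets that assms(3) by blast+
  have notin': "y \<notin> set l" "y \<notin> set h" "y \<notin> set u" "y \<notin> set d" if "y \<in> V" for y
    using sets that assms(3) by blast+
  have "realized_by (V \<union> W) (R \<union> S \<union> R\<inverse> `` {x, z} \<times> S `` {m}) (h @ s @ u) (t @ l) (k1 @ k2 @ d @ k3)"
    apply (rule realized_by_joinI[OF R realized_by_swap[OF S] assms(3)])
    subgoal using dist sets assms(3) by auto
    subgoal by (simp add: precedes_append precedes_notin notin notin')
    subgoal by (simp add: precedes_append precedes_notin notin notin')
    subgoal using RV by auto
    subgoal for p q
    proof -
      assume "p \<in> V" "q \<in> W"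
      then have "precedes (h @ s @ u) p q \<longleftrightarrow> q \<in> set u" "precedes (t @ l) p q"
        "precedes (k1 @ k2 @ d @ k3) p q \<longleftrightarrow> p \<in> set k1 \<union> set k2"
        using sets by (auto simp: precedes_append precedes_notin notin notin')
      then show ?thesis using u inv by blast
    qed
    subgoal for p q
    proof -
      assume "p \<in> V" "q \<in> W"
      then have "\<not> precedes (t @ l) q p" by (simp add: precedes_append precedes_notin notin notin')
      then show ?thesis by blast
    qed
    done
  then show ?thesis by blast
qed

section \<open>Components of forests\<close>

abbreviation linked :: "'a rel \<Rightarrow> 'a rel" where
  "linked E \<equiv> (E \<union> E\<inverse>)\<^sup>*"

definition component :: "'a rel \<Rightarrow> 'a \<Rightarrow> 'a set" where
  "component E p = linked E `` {p}"

definition component_order :: "'a rel \<Rightarrow> 'a \<Rightarrow> 'a rel" where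
  "component_order E p = E\<^sup>* \<inter> component E p \<times> component E p"

text \<open>
  A set of arcs without undirected cycles, expressed by saying that every arc is a bridge.  This form
  passes to subsets of arcs and tells directly that deleting an arc splits its component.
\<close>

definition forest_arcs :: "'a rel \<Rightarrow> bool" where
  "forest_arcs E \<longleftrightarrow> (\<forall>(a, b)\<in>E. (a, b) \<notin> linked (E - {(a, b)}))"

lemma linked_sym: "(x, y) \<in> linked E \<Longrightarrow> (y, x) \<in> linked E"
  by (metis converseD converse_Un converse_converse rtrancl_converseI sup_commute)

lemma linked_mono: "F \<subseteq> E \<Longrightarrow> linked F \<subseteq> linked E"
  by (rule rtrancl_mono) auto

lemma rtrancl_linked: "(x, y) \<in> E\<^sup>* \<Longrightarrow> (x, y) \<in> linked E"
  by (meson in_mono rtrancl_mono sup_ge1)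

lemma forest_arcs_mono:
  assumes "forest_arcs E" "F \<subseteq> E" shows "forest_arcs F"
proof -
  have "(a, b) \<notin> linked (F - {(a, b)})" if "(a, b) \<in> F" for a b
    using assms that linked_mono[of "F - {(a, b)}" "E - {(a, b)}"] unfolding forest_arcs_def by blast
  then show ?thesis unfolding forest_arcs_def by blast
qed

lemma component_self: "p \<in> component E p"
  by (simp add: component_def)

lemma component_iff: "x \<in> component E p \<longleftrightarrow> (p, x) \<in> linked E"
  by (simp add: component_def)

lemma component_eq: "(p, q) \<in> linked E \<Longrightarrow> component E p = component E q"
  unfolding component_def by (auto intro: rtrancl_trans linked_sym)

lemma component_rtrancl:
  assumes "(x, y) \<in> E\<^sup>*" shows "x \<in> component E p \<longleftrightarrow> y \<in> component E p"
  using rtrancl_linked[OF assms] by (meson component_iff linked_sym rtrancl_trans)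

lemma components_disjoint:
  "(a, b) \<notin> linked E \<Longrightarrow> component E a \<inter> component E b = {}"
  unfolding component_def by (blast dest: linked_sym intro: rtrancl_trans)

lemma linked_insert:
  "linked (insert (a, b) F) = linked F \<union> {(x, y). (x, a) \<in> linked F \<and> (b, y) \<in> linked F}
     \<union> {(x, y). (x, b) \<in> linked F \<and> (a, y) \<in> linked F}" (is "_ = ?R")
proof -
  have "insert (a, b) F \<union> (insert (a, b) F)\<inverse> = insert (a, b) (insert (b, a) (F \<union> F\<inverse>))" by auto
  then have "linked (insert (a, b) F) = (insert (a, b) (insert (b, a) (F \<union> F\<inverse>)))\<^sup>*" by simp
  also have "\<dots> = ?R"
    unfolding rtrancl_insert by (auto intro: rtrancl_trans linked_sym)
  finally show ?thesis .
qed

lemma component_insert: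
  "component (insert (a, b) F) a = component F a \<union> component F b"
  "component (insert (a, b) F) b = component F a \<union> component F b"
  unfolding component_def linked_insert by (auto intro: rtrancl_trans linked_sym)

lemma component_order_insert:
  assumes "(a, b) \<notin> linked F"
  shows "component_order (insert (a, b) F) a = join (component_order F a) a b (component_order F b)"
    and "component_order (insert (a, b) F) b = join (component_order F a) a b (component_order F b)"
proof -
  have d: "component F a \<inter> component F b = {}" by (rule components_disjoint[OF assms])
  have "x \<in> component F p \<longleftrightarrow> y \<in> component F p" if "(x, y) \<in> F\<^sup>*" for x y p
    using component_rtrancl[OF that] .
  then show "component_order (insert (a, b) F) a = join (component_order F a) a b (component_order F b)"
    "component_order (insert (a, b) F) b = join (component_order F a) a b (component_order F b)"
    using d component_self[of a F] component_self[of b F]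
    unfolding component_order_def component_insert rtrancl_insert join_def by auto
qed

text \<open>
  An arc at \<open>p\<close> splits the component into the components of its two ends, and \<open>p\<close> is one of these
  ends, so both parts can be taken rooted at the ends of the arc.
\<close>

lemma forest_component_rooted:
  assumes "finite E" "forest_arcs E"
  shows "rooted (component E p) (component_order E p) p"
  using assms
proof (induction E arbitrary: p rule: finite_psubset_induct)
  case (psubset E)
  have split: "\<exists>F. E = insert (a, b) F \<and> F \<subset> E \<and> forest_arcs F \<and> (a, b) \<notin> linked F"
    if "(a, b) \<in> E" for a b
    using that psubset.prems forest_arcs_mono[OF psubset.prems, of "E - {(a, b)}"]
    by (intro exI[of _ "E - {(a, b)}"]) (auto simp: forest_arcs_def)
  consider b where "(p, b) \<in> E" | b where "(b, p) \<in> E" | "\<forall>b. (p, b) \<notin> E \<union> E\<inverse>" by blast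
  then show ?case
  proof cases
    case 1
    then obtain F where F: "E = insert (p, b) F" "F \<subset> E" "forest_arcs F" "(p, b) \<notin> linked F"
        using split by metis
    show ?thesis
      unfolding F(1) component_insert component_order_insert[OF F(4)]
      by (rule rooted_join(1)[OF psubset.IH[OF F(2,3)] psubset.IH[OF F(2,3)]
            components_disjoint[OF F(4)]])
  next
    case 2
    then obtain F where F: "E = insert (b, p) F" "F \<subset> E" "forest_arcs F" "(b, p) \<notin> linked F"
        using split by metis
    show ?thesis
      unfolding F(1) component_insert component_order_insert[OF F(4)]
      by (rule rooted_join(2)[OF psubset.IH[OF F(2,3)] psubset.IH[OF F(2,3)]
            components_disjoint[OF F(4)]])
  next
    case 3
    then have "component E p = {p}" unfolding component_def by (auto elim: converse_rtranclE)
    moreover from this have "component_order E p = {(p, p)}" unfolding component_order_def by auto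
    ultimately show ?thesis using rooted_singleton by simp
  qed
qed

text \<open>
  Consider the last time that a walk from \<open>b\<close> to \<open>v\<close> leaves \<open>b\<close>.  This replaces the choice of a simple
  path when a path is followed vertex by vertex.
\<close>

lemma linked_last_departure:
  assumes "(b, v) \<in> linked E" "b \<noteq> v"
  shows "\<exists>c. (b, c) \<in> E \<union> E\<inverse> \<and> (c, v) \<in> linked {(x, y) \<in> E. x \<noteq> b \<and> y \<noteq> b}"
  using assms
proof (induction rule: rtrancl_induct)
  case base
  then show ?case by simp
next
  case (step y z)
  show ?case
  proof (cases "y = b")
    case True
    then show ?thesis using step.hyps(2) by blast
  next
    case False
    then obtain c where c: "(b, c) \<in> E \<union> E\<inverse>" "(c, y) \<in> linked {(x, y) \<in> E. x \<noteq> b \<and> y \<noteq> b}"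
      using step.IH by blast
    have "(y, z) \<in> {(x, y) \<in> E. x \<noteq> b \<and> y \<noteq> b} \<union> {(x, y) \<in> E. x \<noteq> b \<and> y \<noteq> b}\<inverse>"
      using step False by auto
    then show ?thesis using c by (meson rtrancl.rtrancl_into_rtrancl)
  qed
qed

lemma forest_component_birooted:
  assumes "finite E" "forest_arcs E" "(b, v) \<in> linked E"
  shows "birooted (component E b) (component_order E b) b v"
  using assms
proof (induction E arbitrary: b rule: finite_psubset_induct)
  case (psubset E)
  have split: "\<exists>F. E = insert (a, b) F \<and> F = E - {(a, b)} \<and> F \<subset> E \<and> forest_arcs F \<and>
      (a, b) \<notin> linked F" if "(a, b) \<in> E" for a b
    using that psubset.prems(1) forest_arcs_mono[OF psubset.prems(1), of "E - {(a, b)}"]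
    by (intro exI[of _ "E - {(a, b)}"]) (auto simp: forest_arcs_def)
  show ?case
  proof (cases "b = v")
    case True
    then show ?thesis
      using birooted_refl[OF forest_component_rooted[OF psubset.hyps(1) psubset.prems(1)]] by blast
  next
    case False
    then obtain c where c: "(b, c) \<in> E \<union> E\<inverse>" "(c, v) \<in> linked {(x, y) \<in> E. x \<noteq> b \<and> y \<noteq> b}"
      using linked_last_departure[OF psubset.prems(2)] by blast
    from c(1) show ?thesis
    proof
      assume "(b, c) \<in> E"
      then obtain F where F: "E = insert (b, c) F" "F = E - {(b, c)}" "F \<subset> E" "forest_arcs F"
          "(b, c) \<notin> linked F"
        using split by metis
      have fin: "finite F" using psubset.hyps F(3) finite_subset by blast
      have "(c, v) \<in> linked F" using c(2) linked_mono[of "{(x, y) \<in> E. x \<noteq> b \<and> y \<noteq> b}" F] F(2) by blast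
      then have "birooted (component F c) (component_order F c) c v" using psubset.IH F by blast
      moreover have "rooted (component F b) (component_order F b) b"
        by (rule forest_component_rooted[OF fin F(4)])
      moreover have "component F c \<inter> component F b = {}" using components_disjoint[OF F(5)] by blast
      ultimately show ?thesis
        unfolding F(1) component_insert component_order_insert[OF F(5)] by (rule birooted_join_below)
    next
      assume "(b, c) \<in> E\<inverse>"
      then have "(c, b) \<in> E" by simp
      then obtain F where F: "E = insert (c, b) F" "F = E - {(c, b)}" "F \<subset> E" "forest_arcs F"
          "(c, b) \<notin> linked F"
        using split by metis
      have fin: "finite F" using psubset.hyps F(3) finite_subset by blast
      have "(c, v) \<in> linked F" using c(2) linked_mono[of "{(x, y) \<in> E. x \<noteq> b \<and> y \<noteq> b}" F] F(2) by blast
      then have "birooted (component F c) (component_order F c) c v" using psubset.IH F by blast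
      moreover have "rooted (component F b) (component_order F b) b"
        by (rule forest_component_rooted[OF fin F(4)])
      moreover have "component F c \<inter> component F b = {}" using components_disjoint[OF F(5)] by blast
      ultimately show ?thesis
        unfolding F(1) component_insert component_order_insert[OF F(5)] by (rule birooted_join_above)
    qed
  qed
qed

section \<open>Graphs with at most one cycle\<close>

text \<open>
  Unicyclicity is expressed by the assumption that deleting any arc which is not a bridge leaves a
  forest.  If all arcs are bridges, the component is a tree and any root will do.
\<close>

lemma unicyclic_realized:
  assumes fin: "finite E" and acyc: "acyclic E" and arcs: "\<And>a b. (a, b) \<in> E \<Longrightarrow> (p, a) \<in> linked E"
    and uni: "\<And>a b. (a, b) \<in> E \<Longrightarrow> (a, b) \<in> linked (E - {(a, b)}) \<Longrightarrow> forest_arcs (E - {(a, b)})"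
  shows "\<exists>l1 l2 l3. realized_by (component E p) (component_order E p) l1 l2 l3"
proof (cases "forest_arcs E")
  case True
  then show ?thesis using forest_component_rooted[OF fin True, of p] unfolding rooted_def by blast
next
  case False
  \<comment> \<open>The upper ends of arcs on the cycle; \<open>m\<close> is a maximal one.\<close>
  define N where "N = {b. \<exists>a. (a, b) \<in> E \<and> (a, b) \<in> linked (E - {(a, b)})}"
  have "N \<noteq> {}" using False unfolding forest_arcs_def N_def by blast
  moreover have "wf (E\<inverse>)" using fin acyc by (rule finite_acyclic_wf_converse)
  ultimately obtain m where m: "m \<in> N" "\<And>y. (m, y) \<in> E \<Longrightarrow> y \<notin> N"
    by (metis converse_iff wf_eq_minimal ex_in_conv)
  then obtain x where x: "(x, m) \<in> E" "(x, m) \<in> linked (E - {(x, m)})" unfolding N_def by blast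
  have "x \<noteq> m" using x(1) acyc by (meson acyclic_def r_into_trancl)
  then obtain z where z: "(m, z) \<in> (E - {(x, m)}) \<union> (E - {(x, m)})\<inverse>"
      "(z, x) \<in> linked {(y, y') \<in> E - {(x, m)}. y \<noteq> m \<and> y' \<noteq> m}"
    using linked_last_departure[OF linked_sym[OF x(2)]] by blast
  \<comment> \<open>The second cycle arc at \<open>m\<close> also enters \<open>m\<close>: its other end could otherwise replace \<open>m\<close>.\<close>
  have zE: "(z, m) \<in> E - {(x, m)}"
  proof (rule ccontr)
    assume "\<not> ?thesis"
    then have "(m, z) \<in> E" using z(1) by blast
    have "z \<noteq> m" using \<open>(m, z) \<in> E\<close> acyc by (meson acyclic_def r_into_trancl)
    have "(z, x) \<in> linked (E - {(m, z)})"
      using z(2) linked_mono[of "{(y, y') \<in> E - {(x, m)}. y \<noteq> m \<and> y' \<noteq> m}" "E - {(m, z)}"] by blast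
    moreover have "(x, m) \<in> (E - {(m, z)}) \<union> (E - {(m, z)})\<inverse>" using x(1) \<open>z \<noteq> m\<close> by blast
    ultimately have "(z, m) \<in> linked (E - {(m, z)})" by (rule rtrancl.rtrancl_into_rtrancl)
    then have "(m, z) \<in> linked (E - {(m, z)})" by (rule linked_sym)
    then have "z \<in> N" using \<open>(m, z) \<in> E\<close> unfolding N_def by blast
    then show False using m(2) \<open>(m, z) \<in> E\<close> by blast
  qed
  define F where "F = E - {(x, m), (z, m)}"
  have E: "E = insert (x, m) (insert (z, m) F)" using zE x(1) unfolding F_def by blast
  have forest1: "forest_arcs (E - {(x, m)})" by (rule uni[OF x])
  have F2: "F = E - {(x, m)} - {(z, m)}" unfolding F_def by blast
  have forest: "forest_arcs F" by (rule forest_arcs_mono[OF forest1]) (auto simp: F_def)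
  have zm: "(z, m) \<notin> linked F" using forest1 zE unfolding F2 forest_arcs_def by blast
  have zx: "(z, x) \<in> linked F"
    using z(2) linked_mono[of "{(y, y') \<in> E - {(x, m)}. y \<noteq> m \<and> y' \<noteq> m}" F] unfolding F_def by blast
  then have xm: "(x, m) \<notin> linked F" using zm by (meson rtrancl_trans)
  have finF: "finite F" using fin unfolding F_def by blast
  define R where "R = component_order F x"
  define S where "S = component_order F m"
  have disj: "component F x \<inter> component F m = {}" by (rule components_disjoint[OF xm])
  obtain l1 l2 l3 where l: "realized_by (component F x \<union> component F m)
      (R \<union> S \<union> R\<inverse> `` {x, z} \<times> S `` {m}) l1 l2 l3"
    using birooted_rooted_top[OF forest_component_birooted[OF finF forest linked_sym[OF zx]]
        forest_component_rooted[OF finF forest, of m] disj]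
    unfolding R_def S_def by blast
  define F1 where "F1 = insert (z, m) F"
  have E1: "E = insert (x, m) F1" using E F1_def by simp
  have "component E p = component E x" by (rule component_eq[OF arcs[OF x(1)]])
  also have "\<dots> = component F1 x \<union> component F1 m" unfolding E1 component_insert ..
  also have "component F1 m = component F z \<union> component F m" unfolding F1_def component_insert ..
  also have "component F z = component F x" by (rule component_eq[OF zx])
  also have "component F1 x = component F1 m"
  proof (rule component_eq)
    show "(x, m) \<in> linked F1"
      unfolding F1_def linked_insert using linked_sym[OF zx] by blast
  qed
  also have "\<dots> = component F x \<union> component F m" unfolding F1_def component_insert component_eq[OF zx] ..
  finally have comp: "component E p = component F x \<union> component F m" by simp
  have nm: "(m, x) \<notin> F\<^sup>*" "(m, z) \<notin> F\<^sup>*" 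
    using xm zm rtrancl_linked[of m _ F] linked_sym[of m _ F] by blast+
  have star: "E\<^sup>* = F\<^sup>* \<union> {(y, y'). ((y, x) \<in> F\<^sup>* \<or> (y, z) \<in> F\<^sup>*) \<and> (m, y') \<in> F\<^sup>*}"
    unfolding E rtrancl_insert using nm by auto
  have in_comp: "x \<in> component F x" "z \<in> component F x" "m \<in> component F m"
    using linked_sym[OF zx] by (simp_all add: component_iff)
  have below: "y \<in> component F x" if "(y, x) \<in> F\<^sup>* \<or> (y, z) \<in> F\<^sup>*" for y
    using that component_rtrancl[of y _ F x] in_comp(1,2) by auto
  have above: "y \<in> component F m" if "(m, y) \<in> F\<^sup>*" for y
    using component_rtrancl[OF that] in_comp(3) by simp
  have "R\<inverse> `` {x, z} = {y. (y, x) \<in> F\<^sup>* \<or> (y, z) \<in> F\<^sup>*}"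
    using below in_comp(1,2) unfolding R_def component_order_def by auto
  moreover have "S `` {m} = {y'. (m, y') \<in> F\<^sup>*}"
    using above in_comp(3) unfolding S_def component_order_def by auto
  ultimately have cross: "R\<inverse> `` {x, z} \<times> S `` {m} =
      {(y, y'). ((y, x) \<in> F\<^sup>* \<or> (y, z) \<in> F\<^sup>*) \<and> (m, y') \<in> F\<^sup>*}"
    by auto
  have "F\<^sup>* \<inter> (component F x \<union> component F m) \<times> (component F x \<union> component F m) = R \<union> S"
    using component_rtrancl[of _ _ F x] component_rtrancl[of _ _ F m]
    unfolding R_def S_def component_order_def by auto
  then have "component_order E p = R \<union> S \<union> R\<inverse> `` {x, z} \<times> S `` {m}"
    unfolding component_order_def comp star cross using below above by auto
  then have "realized_by (component E p) (component_order E p) l1 l2 l3" using l by (simp only: comp)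
  then show ?thesis by blast
qed

section \<open>The cover graph of a finite poset\<close>

lemma realized_order_dimension:
  assumes "partial_order_on A r" "realized_by A r l1 l2 l3"
  shows "order_dimension A r \<le> 3"
proof -
  define lin where "lin l = {(x, y). precedes l x y}" for l :: "'a list"
  have d: "distinct l" "set l = A" if "l \<in> {l1, l2, l3}" for l
    using assms(2) that unfolding realized_by_def by blast+
  have r: "(x, y) \<in> r \<longleftrightarrow> x \<in> A \<and> y \<in> A \<and> (\<forall>l\<in>{l1, l2, l3}. precedes l x y)" for x y
    using assms(2) unfolding realized_by_def by blast
  have "linear_extension A r (lin l)" if l: "l \<in> {l1, l2, l3}" for l
  proof -
    have "lin l \<subseteq> A \<times> A" "refl_on A (lin l)" "total_on A (lin l)"
      unfolding lin_def refl_on_def total_on_def d(2)[OF l, symmetric]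
      using precedes_in[of l] precedes_total[of _ l] precedes_refl[of _ l] by blast+
    moreover have "antisym (lin l)" "trans (lin l)"
      unfolding lin_def antisym_def trans_def
      using precedes_antisym[OF d(1)[OF l]] precedes_trans[OF d(1)[OF l]] by blast+
    ultimately have "linear_order_on A (lin l)" unfolding order_on_defs by blast
    moreover have "r \<subseteq> lin l"
    proof
      fix e assume "e \<in> r"
      then show "e \<in> lin l" using r[of "fst e" "snd e"] l
        unfolding lin_def by (auto simp: case_prod_beta)
    qed
    ultimately show ?thesis unfolding linear_extension_def by blast
  qed
  moreover have "(x, y) \<in> r \<longleftrightarrow> (\<forall>l\<in>lin ` {l1, l2, l3}. (x, y) \<in> l)" if "x \<in> A" "y \<in> A" for x y
    using r[of x y] that by (simp add: lin_def)
  ultimately have "realizer A r (lin ` {l1, l2, l3})"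
    unfolding realizer_def by blast
  moreover have "card (lin ` {l1, l2, l3}) \<le> 3"
    by (rule order.trans[OF card_image_le]) (simp_all add: card_insert_if)
  moreover have "finite (lin ` {l1, l2, l3})" by simp
  ultimately have "\<exists>L. finite L \<and> card L \<le> 3 \<and> realizer A r L" by (intro exI conjI)
  then have "order_dimension A r \<le> enat 3" by (simp only: order_dimension_le_iff)
  then show ?thesis by (simp add: numeral_eq_enat)
qed

text \<open>
  A comparable pair that is not a covering pair has an element strictly between, and both resulting
  intervals are smaller.
\<close>

lemma finite_order_rtrancl_covers:
  assumes "finite A" "partial_order_on A r"
  shows "r = (parcs (hasse_diagram A r))\<^sup>* \<inter> A \<times> A"
proof -
  let ?E = "parcs (hasse_diagram A r)"
  have E: "(x, y) \<in> ?E \<longleftrightarrow> (x, y) \<in> r \<and> x \<noteq> y \<and> \<not> (\<exists>z. z \<noteq> x \<and> z \<noteq> y \<and> (x, z) \<in> r \<and> (z, y) \<in> r)" for x y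
    by (simp add: hasse_diagram_def)
  have po: "r \<subseteq> A \<times> A" "\<And>x. x \<in> A \<Longrightarrow> (x, x) \<in> r" "trans r" "antisym r"
    using assms(2) by (auto simp: order_on_defs refl_on_def)
  have "(x, y) \<in> ?E\<^sup>*" if "(x, y) \<in> r" for x y
    using that
  proof (induction "card {z. (x, z) \<in> r \<and> (z, y) \<in> r}" arbitrary: x y rule: less_induct)
    case less
    have fin: "finite {z. (x, z) \<in> r \<and> (z, y) \<in> r}"
      by (rule finite_subset[OF _ assms(1)]) (use po(1) in blast)
    show ?case
    proof (cases "x = y \<or> (x, y) \<in> ?E")
      case True
      then show ?thesis by auto
    next
      case False
      then obtain z where z: "z \<noteq> x" "z \<noteq> y" "(x, z) \<in> r" "(z, y) \<in> r" using E less.prems by blast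
      have refl: "(x, x) \<in> r" "(y, y) \<in> r" using less.prems po by blast+
      have "{w. (x, w) \<in> r \<and> (w, z) \<in> r} \<subset> {w. (x, w) \<in> r \<and> (w, y) \<in> r}"
      proof
        show "{w. (x, w) \<in> r \<and> (w, z) \<in> r} \<subseteq> {w. (x, w) \<in> r \<and> (w, y) \<in> r}"
          using z po(3) by (auto dest: transD)
        have "(y, z) \<notin> r" using z po(4) by (auto dest: antisymD)
        then show "{w. (x, w) \<in> r \<and> (w, z) \<in> r} \<noteq> {w. (x, w) \<in> r \<and> (w, y) \<in> r}"
          using less.prems refl by blast
      qed
      then have 1: "(x, z) \<in> ?E\<^sup>*" using less.hyps[OF psubset_card_mono[OF fin]] z by blast
      have "{w. (z, w) \<in> r \<and> (w, y) \<in> r} \<subset> {w. (x, w) \<in> r \<and> (w, y) \<in> r}"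
      proof
        show "{w. (z, w) \<in> r \<and> (w, y) \<in> r} \<subseteq> {w. (x, w) \<in> r \<and> (w, y) \<in> r}"
          using z po(3) by (auto dest: transD)
        have "(z, x) \<notin> r" using z po(4) by (auto dest: antisymD)
        then show "{w. (z, w) \<in> r \<and> (w, y) \<in> r} \<noteq> {w. (x, w) \<in> r \<and> (w, y) \<in> r}"
          using less.prems refl by blast
      qed
      then have "(z, y) \<in> ?E\<^sup>*" using less.hyps[OF psubset_card_mono[OF fin]] z by blast
      with 1 show ?thesis by (rule rtrancl_trans)
    qed
  qed
  moreover have "(x, y) \<in> r" if "(x, y) \<in> ?E\<^sup>*" "x \<in> A" for x y
    using that by (induction rule: rtrancl_induct) (use po E in \<open>auto dest: transD\<close>)
  ultimately show ?thesis using po(1) by auto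
qed

text \<open>
  A simple path from \<open>b\<close> back to \<open>a\<close> that avoids the arc \<open>(a, b)\<close> closes up to a cycle.  It has at
  least three arcs because \<open>E\<close> does not contain \<open>(b, a)\<close>.  Working inside a subset \<open>F\<close> makes it possible
  to produce a cycle that avoids a given edge.
\<close>

lemma non_bridge_on_cycle:
  fixes A :: "'a set"
  assumes G: "pverts G = A" "parcs G = E \<union> E\<inverse>" and EA: "E \<subseteq> A \<times> A"
    and as: "\<And>a b. (a, b) \<in> E \<Longrightarrow> (b, a) \<notin> E"
    and F: "F \<subseteq> E" and ab: "(a, b) \<in> F" "(a, b) \<in> linked (F - {(a, b)})"
  shows "\<exists>C\<in>undirected_cycles G. {a, b} \<in> C \<and> C \<subseteq> (\<lambda>(x, y). {x, y}) ` F"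
proof -
  define F' where "F' = F - {(a, b)}"
  define H where "H = \<lparr>pverts = A, parcs = F' \<union> F'\<inverse>\<rparr>"
  have H: "pverts H = A" "parcs H = F' \<union> F'\<inverse>" by (simp_all add: H_def)
  have abA: "a \<in> A" "b \<in> A" "(b, a) \<notin> F" using ab EA F as by blast+
  interpret H: pair_wf_digraph H
    by unfold_locales (use EA F in \<open>auto simp: H F'_def\<close>)
  interpret G: pair_wf_digraph G
    by unfold_locales (use EA in \<open>auto simp: G\<close>)
  have "b \<rightarrow>\<^sup>*\<^bsub>with_proj H\<^esub> a"
    using linked_sym[OF ab(2)] unfolding F'_def[symmetric]
  proof (induction rule: rtrancl_induct)
    case base
    then show ?case using abA by (simp add: H)
  next
    case (step y z)
    have "(y, z) \<in> parcs H" using step.hyps(2) by (simp add: H)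
    with step.IH show ?case by (rule H.reachable_adj_trans)
  qed
  then obtain p where "H.awalk b p a" using H.reachable_awalk by blast
  then have "\<exists>p. H.apath b p a" using H.apath_awalk_to_apath by blast
  then obtain p where p: "H.awalk b p a" "distinct (H.awalk_verts b p)" unfolding H.apath_def by blast
  have pF: "set p \<subseteq> F' \<union> F'\<inverse>" using p(1) H by (auto simp: H.awalk_def)
  have "H.cas b p a" using p(1) unfolding H.awalk_def by blast
  then have "G.cas a ((a, b) # p) a" by simp
  moreover have "set ((a, b) # p) \<subseteq> arcs (with_proj G)"
    using pF F ab(1) by (auto simp: G F'_def)
  ultimately have "G.awalk a ((a, b) # p) a"
    using abA(1) unfolding G.awalk_def by (simp add: G)
  moreover have "distinct (tl (G.awalk_verts a ((a, b) # p)))" using p(2) by simp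
  ultimately have "G.cycle ((a, b) # p)" unfolding G.cycle_def by blast
  moreover have "3 \<le> length ((a, b) # p)"
  proof -
    have "p \<noteq> []" using p(1) abA ab(1) as F by (auto simp: H.awalk_def)
    moreover have "p \<noteq> [e]" for e
    proof
      assume "p = [e]"
      then have "e = (b, a)" using p(1) by (cases e) (auto simp: H.awalk_def)
      then have "(b, a) \<in> F' \<union> F'\<inverse>" using pF \<open>p = [e]\<close> by simp
      then show False using abA(3) unfolding F'_def by blast
    qed
    ultimately have "2 \<le> length p" by (cases p rule: remdups_adj.cases) auto
    then show ?thesis by simp
  qed
  ultimately have "(\<lambda>(u, v). {u, v}) ` set ((a, b) # p) \<in> undirected_cycles G"
    unfolding undirected_cycles_def by blast
  moreover have "(\<lambda>(u, v). {u, v}) ` set ((a, b) # p) \<subseteq> (\<lambda>(x, y). {x, y}) ` F"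
  proof
    fix C assume "C \<in> (\<lambda>(u, v). {u, v}) ` set ((a, b) # p)"
    then obtain u v where "C = {u, v}" "(u, v) \<in> F \<or> (v, u) \<in> F" using pF ab(1) by (auto simp: F'_def)
    then have "C = (\<lambda>(x, y). {x, y}) (u, v) \<and> (u, v) \<in> F \<or> C = (\<lambda>(x, y). {x, y}) (v, u) \<and> (v, u) \<in> F"
      by (simp add: insert_commute)
    then show "C \<in> (\<lambda>(x, y). {x, y}) ` F" by blast
  qed
  moreover have "{a, b} \<in> (\<lambda>(u, v). {u, v}) ` set ((a, b) # p)" by simp
  ultimately show ?thesis by (intro bexI conjI)
qed

theorem theorem1p1:
  fixes A :: "'a set" and r :: "'a rel"
  assumes "finite A"
    and "unicycle_poset A r"
  shows "order_dimension A r \<le> 3"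
proof -
  let ?G = "cover_graph A r"
  define E where "E = parcs (hasse_diagram A r)"
  have po: "partial_order_on A r" and con: "Digraph_Component.connected (with_proj ?G)"
    and uni: "\<And>C C'. C \<in> undirected_cycles ?G \<Longrightarrow> C' \<in> undirected_cycles ?G \<Longrightarrow> C = C'"
    using assms(2) unfolding unicycle_poset_def by blast+
  have Er: "E \<subseteq> r" "\<And>x. (x, x) \<notin> E" unfolding E_def hasse_diagram_def by auto
  have rA: "r \<subseteq> A \<times> A" "antisym r" "trans r" using po by (auto simp: order_on_defs)
  have EA: "E \<subseteq> A \<times> A" using Er(1) rA(1) by blast
  have as: "(b, a) \<notin> E" if "(a, b) \<in> E" for a b
    using that Er rA(2) by (metis antisymD subsetD)
  have finE: "finite E" using EA assms(1) finite_subset by blast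
  have acyc: "acyclic E"
  proof -
    have "E\<^sup>+ \<subseteq> r" using trancl_mono_subset[OF Er(1)] rA(3) by (simp add: trancl_id)
    show ?thesis
    proof (rule acyclicI, intro allI notI)
      fix x assume "(x, x) \<in> E\<^sup>+"
      then obtain y where "(x, y) \<in> E" "(y, x) \<in> E\<^sup>*" by (meson tranclD)
      then show False
        using \<open>E\<^sup>+ \<subseteq> r\<close> Er rA(2) by (metis antisymD rtranclD subsetD)
    qed
  qed
  have G: "pverts ?G = A" "parcs ?G = E \<union> E\<inverse>"
    unfolding cover_graph_def E_def by (auto simp: mk_symmetric_def hasse_diagram_def)
  have parcs2: "parcs (mk_symmetric (with_proj ?G)) = E \<union> E\<inverse>" "pverts (mk_symmetric (with_proj ?G)) = A"
    unfolding mk_symmetric_def by (auto simp: G)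
  have reach: "(u, v) \<in> linked E" if "u \<in> A" "v \<in> A" for u v
  proof -
    have "u \<rightarrow>\<^sup>*\<^bsub>with_proj (mk_symmetric (with_proj ?G))\<^esub> v"
      using con that unfolding connected_def strongly_connected_def by (simp add: parcs2 G)
    then show ?thesis
      unfolding reachable_def by (simp add: parcs2) (meson rtrancl_on_rtranclI)
  qed
  obtain p where p: "p \<in> A" using con unfolding connected_def strongly_connected_def by (auto simp: G)
  have comp: "component E p = A"
  proof
    show "A \<subseteq> component E p" using reach p by (auto simp: component_iff)
    have "x \<in> A" if "(p, x) \<in> linked E" for x
      using that by (induction rule: rtrancl_induct) (use p EA in auto)
    then show "component E p \<subseteq> A" by (auto simp: component_iff)
  qed
  have "\<exists>l1 l2 l3. realized_by (component E p) (component_order E p) l1 l2 l3"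
  proof (rule unicyclic_realized[OF finE acyc])
    show "(p, a) \<in> linked E" if "(a, b) \<in> E" for a b using reach p that EA by blast
    \<comment> \<open>If an arc \<open>(c, d)\<close> were not a bridge even without \<open>(a, b)\<close>, there would be a cycle through
      \<open>{a, b}\<close> and another one avoiding it.\<close>
    show "forest_arcs (E - {(a, b)})" if ab: "(a, b) \<in> E" "(a, b) \<in> linked (E - {(a, b)})" for a b
    proof (rule ccontr)
      assume "\<not> forest_arcs (E - {(a, b)})"
      then obtain c d where cd: "(c, d) \<in> E - {(a, b)}" "(c, d) \<in> linked (E - {(a, b)} - {(c, d)})"
        unfolding forest_arcs_def by blast
      obtain C where C: "C \<in> undirected_cycles ?G" "{a, b} \<in> C"
        using non_bridge_on_cycle[OF G EA as subset_refl ab] by blast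
      obtain C' where C': "C' \<in> undirected_cycles ?G" "C' \<subseteq> (\<lambda>(x, y). {x, y}) ` (E - {(a, b)})"
        using non_bridge_on_cycle[OF G EA as Diff_subset cd] by blast
      have "{a, b} \<in> (\<lambda>(x, y). {x, y}) ` (E - {(a, b)})" using C C' uni by blast
      then show False using as ab(1) by (auto simp: doubleton_eq_iff)
    qed
  qed
  moreover have "component_order E p = r"
    unfolding component_order_def comp
    by (rule finite_order_rtrancl_covers[OF assms(1) po, folded E_def, symmetric])
  ultimately show ?thesis using realized_order_dimension[OF po] comp by auto
qed
end
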